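(* Let $P\subset\mathbb{H}^3$ be a convex ideal polyhedron which is a fundamental polyhedron for a Kleinian group $G$, such that no face pairing transformation is elliptic and, for every edge class, the interior dihedral angles of $P$ at the edges of the class sum to $2\pi$. Then there is a squared term in some relator of $G$ if and only if some pair of adjacent faces of $P$ (two faces sharing an edge) are identified with each other by a face pairing transformation.
   Context: A Kleinian group is a discrete group of orientation-preserving isometries of $\mathbb{H}^3$. A fundamental polyhedron $P$ for $G$ is a convex polyhedron such that: its faces are arranged in pairs $(\sigma,\sigma')$ of distinct faces, each pair having a face pairing transformation $g\in G$ with $g(\sigma)=\sigma'$ and $g(P)\cap P=\sigma'$; the translates of $P$ under $G$ fill $\mathbb{H}^3$ without overlap of interiors; the face pairing transformations generate $G$, and the edge relations generate the relations of $G$. The edge classes are the equivalence classes of edges of $P$ under the identifications induced by the face pairing transformations. The generators of $G$ are the face pairing transformations. The relators are the words attached to edge classes as follows: start at an edge $e_1$ regarded as an edge of one of its two faces $\sigma_1$; let $g_1$ (a generator or the inverse of one) be the transformation pairing $\sigma_1$ with its partner face, and put $e_2=g_1(e_1)$; regard $e_2$ as an edge of the face containing it other than $g_1(\sigma_1)$, apply the transformation $g_2$ pairing that face with its partner, and so on, until one returns to the starting edge $e_1$. The relator is the word $g_1g_2\cdots g_n$ (letters in order of application), considered up to cyclic permutation. A relator has a squared term if, after a suitable cyclic permutation, two consecutive letters are the same letter $X$, where $X$ is a generator or the inverse of a generator. *)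

theory Defs
  imports
    "HOL-Analysis.Analysis"
    "HOL-Algebra.Bij"
    "HOL-Algebra.Generated_Groups"
begin

text \<open>
  Hyperbolic 3-space is taken in the Beltrami-Klein model: the open unit ball, in which hyperbolic
  segments, convex sets, half-spaces and planes are the traces of the Euclidean ones, and whose
  ideal points are those of the unit sphere. Faces and edges of a convex polyhedron are therefore
  given by the library's affine notions \<open>facet_of\<close> and \<open>edge_of\<close>. A point \<open>x\<close> is
  also viewed as the ray through the vector \<open>(x, 1)\<close> of Minkowski space \<open>\<real>\<^sup>3 \<times> \<real>\<close>.
\<close>

type_synonym point = "real ^ 3"
type_synonym isom = "point \<Rightarrow> point"

definition H3 :: "point set" where
  "H3 = ball 0 1"

definition lorentz :: "point \<times> real \<Rightarrow> point \<times> real \<Rightarrow> real" where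
  "lorentz u v = fst u \<bullet> fst v - snd u * snd v"

definition hdist :: "point \<Rightarrow> point \<Rightarrow> real" where
  "hdist x y = arcosh (- lorentz (x, 1) (y, 1)
     / sqrt (lorentz (x, 1) (x, 1) * lorentz (y, 1) (y, 1)))"

text \<open>
  Transformations are elements of \<open>BijGroup H3\<close>, i.e. extensional functions: their
  value outside \<open>H3\<close> is \<open>undefined\<close>. Derivatives at points of the open set
  \<open>H3\<close> do not see this.
\<close>

definition isometry :: "isom \<Rightarrow> bool" where
  "isometry f \<longleftrightarrow> f \<in> Bij H3 \<and> (\<forall>x\<in>H3. \<forall>y\<in>H3. hdist (f x) (f y) = hdist x y)"

definition orientation_preserving :: "isom \<Rightarrow> bool" where
  "orientation_preserving f \<longleftrightarrow>
     (\<forall>x\<in>H3. f differentiable (at x) \<and> det (matrix (frechet_derivative f (at x))) > 0)"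

text \<open>
  Discreteness refers to the product topology on functions, i.e. pointwise convergence; on
  isometries it coincides with the compact-open topology.
\<close>

definition kleinian_group :: "isom set \<Rightarrow> bool" where
  "kleinian_group G \<longleftrightarrow> subgroup G (BijGroup H3) \<and>
     (\<forall>g\<in>G. isometry g \<and> orientation_preserving g) \<and> discrete G"

definition elliptic :: "isom \<Rightarrow> bool" where
  "elliptic g \<longleftrightarrow> isometry g \<and> orientation_preserving g \<and>
     g \<noteq> \<one>\<^bsub>BijGroup H3\<^esub> \<and> (\<exists>x\<in>H3. g x = x)"

definition convex_polyhedron :: "point set \<Rightarrow> bool" where
  "convex_polyhedron P \<longleftrightarrow> (\<exists>Q. polyhedron Q \<and> P = Q \<inter> H3) \<and> interior P \<noteq> {}"

definition convex_ideal_polyhedron :: "point set \<Rightarrow> bool" where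
  "convex_ideal_polyhedron P \<longleftrightarrow>
     (\<exists>V. finite V \<and> V \<subseteq> sphere 0 1 \<and> P = convex hull V \<inter> H3) \<and> interior P \<noteq> {}"

definition adjacent_faces :: "point set \<Rightarrow> point set \<Rightarrow> point set \<Rightarrow> bool" where
  "adjacent_faces P \<sigma> \<tau> \<longleftrightarrow> \<sigma> facet_of P \<and> \<tau> facet_of P \<and> \<sigma> \<noteq> \<tau> \<and>
     (\<exists>e. e edge_of P \<and> e \<subseteq> \<sigma> \<and> e \<subseteq> \<tau>)"

text \<open>
  A hyperbolic plane is the Lorentz-orthogonal complement of a spacelike vector. At a common point
  of two planes, the angle between their normal directions is the arccosine of the Lorentz product
  of their unit normals; the interior dihedral angle is the supplement of the angle between the
  outer normals.
\<close>

definition outer_unit_normal :: "point set \<Rightarrow> point set \<Rightarrow> point \<times> real \<Rightarrow> bool" where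
  "outer_unit_normal P \<sigma> n \<longleftrightarrow> lorentz n n = 1 \<and>
     (\<forall>x\<in>P. lorentz n (x, 1) \<le> 0) \<and> \<sigma> = {x\<in>P. lorentz n (x, 1) = 0}"

definition dihedral_angle :: "point set \<Rightarrow> point set \<Rightarrow> real" where
  "dihedral_angle P e = (THE \<theta>. \<exists>\<sigma> \<tau> m n.
     \<sigma> facet_of P \<and> \<tau> facet_of P \<and> \<sigma> \<noteq> \<tau> \<and> e \<subseteq> \<sigma> \<and> e \<subseteq> \<tau> \<and>
     outer_unit_normal P \<sigma> m \<and> outer_unit_normal P \<tau> n \<and>
     \<theta> = pi - arccos (lorentz m n))"

text \<open>
  The face pairing is given by \<open>mate\<close>, sending a face to its partner, and \<open>\<phi>\<close>,
  sending a face \<open>\<sigma>\<close> to the transformation that carries \<open>\<sigma>\<close> to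
  \<open>mate \<sigma>\<close>. The transformations of the two faces of a pair are mutually
  inverse, so the letters (generators and their inverses) are exactly the \<open>\<phi> \<sigma>\<close>.
\<close>

definition face_pairing ::
  "isom set \<Rightarrow> point set \<Rightarrow> (point set \<Rightarrow> point set) \<Rightarrow> (point set \<Rightarrow> isom) \<Rightarrow> bool" where
  "face_pairing G P mate \<phi> \<longleftrightarrow> (\<forall>\<sigma>. \<sigma> facet_of P \<longrightarrow>
     mate \<sigma> facet_of P \<and> mate \<sigma> \<noteq> \<sigma> \<and> mate (mate \<sigma>) = \<sigma> \<and>
     \<phi> \<sigma> \<in> G \<and> \<phi> \<sigma> ` \<sigma> = mate \<sigma> \<and> \<phi> \<sigma> ` P \<inter> P = mate \<sigma> \<and>
     \<phi> (mate \<sigma>) = inv\<^bsub>BijGroup H3\<^esub> \<phi> \<sigma>)"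

definition edge_class :: "point set \<Rightarrow> (point set \<Rightarrow> isom) \<Rightarrow> point set \<Rightarrow> point set set" where
  "edge_class P \<phi> e = {e'. equivclp
     (\<lambda>a b. \<exists>\<sigma>. \<sigma> facet_of P \<and> a edge_of P \<and> a \<subseteq> \<sigma> \<and> b = \<phi> \<sigma> ` a) e e'}"

text \<open>
  \<open>es\<close> lists the edges \<open>e\<^sub>1, \<dots>, e\<^sub>n\<close> met, and \<open>ss\<close> the faces
  \<open>\<sigma>\<^sub>1, \<dots>, \<sigma>\<^sub>n\<close> they are regarded as edges of. The process stops at the first return
  to \<open>e\<^sub>1\<close>, whence the last condition.
\<close>

definition edge_cycle ::
  "point set \<Rightarrow> (point set \<Rightarrow> point set) \<Rightarrow> (point set \<Rightarrow> isom) \<Rightarrow>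
   point set list \<Rightarrow> point set list \<Rightarrow> bool" where
  "edge_cycle P mate \<phi> es ss \<longleftrightarrow> es \<noteq> [] \<and> length ss = length es \<and>
     (\<forall>i<length es. es ! i edge_of P \<and> ss ! i facet_of P \<and> es ! i \<subseteq> ss ! i) \<and>
     (\<forall>i. Suc i < length es \<longrightarrow>
        es ! Suc i = \<phi> (ss ! i) ` (es ! i) \<and> ss ! Suc i \<noteq> mate (ss ! i)) \<and>
     \<phi> (last ss) ` last es = hd es \<and> hd es \<notin> set (tl es)"

definition relator ::
  "point set \<Rightarrow> (point set \<Rightarrow> point set) \<Rightarrow> (point set \<Rightarrow> isom) \<Rightarrow> isom list \<Rightarrow> bool" where
  "relator P mate \<phi> w \<longleftrightarrow> (\<exists>es ss. edge_cycle P mate \<phi> es ss \<and> w = map \<phi> ss)"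

definition has_squared_term :: "'a list \<Rightarrow> bool" where
  "has_squared_term w \<longleftrightarrow> (\<exists>k u X v. rotate k w = u @ [X, X] @ v)"

text \<open>The letters of a word are applied from left to right.\<close>

definition word_value :: "isom list \<Rightarrow> isom" where
  "word_value w = foldl (\<lambda>h g. g \<otimes>\<^bsub>BijGroup H3\<^esub> h) \<one>\<^bsub>BijGroup H3\<^esub> w"

text \<open>
  The equivalence relation generated by \<open>elementary_reduction\<close> identifies two words in the
  letters iff they agree in the group presented by the generators and the relators.
\<close>

inductive elementary_reduction ::
  "point set \<Rightarrow> (point set \<Rightarrow> point set) \<Rightarrow> (point set \<Rightarrow> isom) \<Rightarrow> isom list \<Rightarrow> isom list \<Rightarrow> bool"
  for P mate \<phi> where
  cancel: "\<lbrakk>\<sigma> facet_of P; set u \<subseteq> \<phi> ` {\<tau>. \<tau> facet_of P}; set v \<subseteq> \<phi> ` {\<tau>. \<tau> facet_of P}\<rbrakk>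
    \<Longrightarrow> elementary_reduction P mate \<phi> (u @ [\<phi> \<sigma>, \<phi> (mate \<sigma>)] @ v) (u @ v)"
| relator: "\<lbrakk>relator P mate \<phi> r; set u \<subseteq> \<phi> ` {\<tau>. \<tau> facet_of P}; set v \<subseteq> \<phi> ` {\<tau>. \<tau> facet_of P}\<rbrakk>
    \<Longrightarrow> elementary_reduction P mate \<phi> (u @ r @ v) (u @ v)"

definition edge_relations_generate ::
  "point set \<Rightarrow> (point set \<Rightarrow> point set) \<Rightarrow> (point set \<Rightarrow> isom) \<Rightarrow> bool" where
  "edge_relations_generate P mate \<phi> \<longleftrightarrow>
     (\<forall>w. set w \<subseteq> \<phi> ` {\<sigma>. \<sigma> facet_of P} \<longrightarrow>
        (word_value w = \<one>\<^bsub>BijGroup H3\<^esub> \<longleftrightarrow> equivclp (elementary_reduction P mate \<phi>) w []))"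

definition fundamental_polyhedron ::
  "isom set \<Rightarrow> point set \<Rightarrow> (point set \<Rightarrow> point set) \<Rightarrow> (point set \<Rightarrow> isom) \<Rightarrow> bool" where
  "fundamental_polyhedron G P mate \<phi> \<longleftrightarrow>
     convex_polyhedron P \<and>
     face_pairing G P mate \<phi> \<and>
     (\<Union>g\<in>G. g ` P) = H3 \<and>
     (\<forall>g\<in>G. \<forall>h\<in>G. g \<noteq> h \<longrightarrow> g ` interior P \<inter> h ` interior P = {}) \<and>
     generate (BijGroup H3) (\<phi> ` {\<sigma>. \<sigma> facet_of P}) = G \<and>
     edge_relations_generate P mate \<phi>"

end

theory Submission
  imports Defs
begin

text \<open>
  A letter determines its face, because \<open>\<phi> \<sigma> ` P \<inter> P = mate \<sigma>\<close>. So if in a relator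
  the letter of \<open>\<sigma>\<close> is followed by itself, the edge reached between the two letters lies in
  \<open>mate \<sigma>\<close>, as an image under \<open>\<phi> \<sigma>\<close>, and in \<open>\<sigma>\<close>, as the next edge to be mapped by
  \<open>\<phi> \<sigma>\<close>. Hence these two faces are adjacent.

  Conversely let \<open>\<sigma>\<close> and \<open>mate \<sigma>\<close> share an edge \<open>e\<close>. The process that
  starts at the edge \<open>e\<^sub>1\<close> that \<open>\<phi> \<sigma>\<close> maps to \<open>e\<close>, regarded as an edge of
  \<open>\<sigma>\<close>, reaches \<open>e\<close> after one step. The face of \<open>e\<close> other than \<open>mate \<sigma>\<close>
  is \<open>\<sigma>\<close>, so the second letter equals the first, provided that the process does not stop
  after one step, i.e. that \<open>e\<^sub>1 \<noteq> e\<close>. If \<open>e\<^sub>1 = e\<close>, then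
  both faces of \<open>e\<close> are paired by maps that fix \<open>e\<close>, so \<open>e\<close> is alone in its edge class. The
  angle sum then says that the dihedral angle at \<open>e\<close> is \<open>2\<pi>\<close>, but the dihedral angle of a convex
  polyhedron is at most \<open>\<pi>\<close>.

  The argument rests on three geometric facts. Each edge lies in exactly two faces
  (\<open>edge_in_two_facets\<close>), so that the process is well defined, reversible, and
  therefore periodic on the finite set of flags (\<open>edge_cycle_from_flag\<close>). Isometries
  preserve the segments of the Klein model (\<open>isometry_open_segment\<close>), hence carry the edges of a
  face to edges of its partner. Facets have unique outer unit normals, so that the
  dihedral angle is determined and at most \<open>\<pi>\<close> (\<open>dihedral_angle_le_pi\<close>).
\<close>

section \<open>Hyperbolic isometries preserve segments\<close>

lemma lorentz_point: "lorentz m (x, 1) = fst m \<bullet> x - snd m"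
  by (simp add: lorentz_def)

lemma lorentz_add_left: "lorentz (u + v) w = lorentz u w + lorentz v w"
  and lorentz_diff_left: "lorentz (u - v) w = lorentz u w - lorentz v w"
  and lorentz_scaleR_left: "lorentz (c *\<^sub>R u) w = c * lorentz u w"
  by (simp_all add: lorentz_def algebra_simps)

lemma lorentz_add_right: "lorentz w (u + v) = lorentz w u + lorentz w v"
  and lorentz_diff_right: "lorentz w (u - v) = lorentz w u - lorentz w v"
  and lorentz_scaleR_right: "lorentz w (c *\<^sub>R u) = c * lorentz w u"
  by (simp_all add: lorentz_def algebra_simps)

lemmas lorentz_bilinear =
  lorentz_add_left lorentz_diff_left lorentz_scaleR_left
  lorentz_add_right lorentz_diff_right lorentz_scaleR_right

lemma lorentz_commute: "lorentz u v = lorentz v u"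
  by (simp add: lorentz_def inner_commute mult.commute)

lemma H3_iff: "x \<in> H3 \<longleftrightarrow> norm x < 1"
  by (simp add: H3_def)

text \<open>
  The Lorentz form is positive definite on the orthogonal complement of a timelike vector.
\<close>

lemma lorentz_orthogonal_point_nonneg:
  assumes x: "x \<in> H3" and orth: "lorentz s (x, 1) = 0"
  shows "lorentz s s \<ge> 0" and "lorentz s s = 0 \<Longrightarrow> s = 0"
proof -
  obtain b r where s: "s = (b, r)" by (cases s)
  have r: "r = b \<bullet> x" using orth s by (simp add: lorentz_point)
  have nx: "(norm x)\<^sup>2 < 1"
    using x by (simp add: H3_iff abs_square_less_1)
  have "r\<^sup>2 \<le> (norm b)\<^sup>2 * (norm x)\<^sup>2"
    using Cauchy_Schwarz_ineq[of b x] r by (simp add: power2_norm_eq_inner)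
  moreover have L: "lorentz s s = (norm b)\<^sup>2 - r\<^sup>2"
    by (simp add: s lorentz_def dot_square_norm power2_eq_square)
  ultimately have bound: "lorentz s s \<ge> (norm b)\<^sup>2 * (1 - (norm x)\<^sup>2)"
    by (simp add: algebra_simps)
  moreover have "(norm b)\<^sup>2 * (1 - (norm x)\<^sup>2) \<ge> 0" using nx by simp
  ultimately show "lorentz s s \<ge> 0" by linarith
  show "s = 0" if "lorentz s s = 0"
  proof -
    have "(norm b)\<^sup>2 * (1 - (norm x)\<^sup>2) \<le> 0" using bound that by simp
    then have "b = 0"
      using nx by (simp add: mult_le_0_iff)
    then show ?thesis using s r by (simp add: zero_prod_def)
  qed
qed

definition hyperboloid_point :: "point \<Rightarrow> point \<times> real" where
  "hyperboloid_point x = (1 / sqrt (1 - x \<bullet> x)) *\<^sub>R (x, 1)"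

lemma H3_inner_less_1: "x \<in> H3 \<Longrightarrow> x \<bullet> x < 1"
  by (simp add: H3_iff norm_eq_sqrt_inner real_sqrt_lt_1_iff)

lemma snd_hyperboloid_point_pos: "x \<in> H3 \<Longrightarrow> snd (hyperboloid_point x) > 0"
  using H3_inner_less_1 by (simp add: hyperboloid_point_def)

lemma hyperboloid_point_eq: "hyperboloid_point x = snd (hyperboloid_point x) *\<^sub>R (x, 1)"
  by (simp add: hyperboloid_point_def)

text \<open>Reverse Cauchy-Schwarz inequality for timelike vectors.\<close>

lemma lorentz_hyperboloid_ge_1:
  assumes x: "x \<in> H3" and y: "y \<in> H3"
  shows "- lorentz (hyperboloid_point x) (hyperboloid_point y) \<ge> 1"
proof -
  have nx: "x \<bullet> x < 1" and ny: "y \<bullet> y < 1"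
    using H3_inner_less_1 x y by auto
  have xy: "x \<bullet> y \<le> norm x * norm y" by (rule norm_cauchy_schwarz)
  have n1: "norm x * norm y \<le> 1"
    using x y by (simp add: H3_iff mult_le_one)
  have "(1 - x \<bullet> x) * (1 - y \<bullet> y) \<le> (1 - norm x * norm y)\<^sup>2"
  proof -
    have "(1 - norm x * norm y)\<^sup>2 - (1 - (norm x)\<^sup>2) * (1 - (norm y)\<^sup>2) = (norm x - norm y)\<^sup>2"
      by (simp add: power2_eq_square algebra_simps)
    moreover have "(norm x - norm y)\<^sup>2 \<ge> 0" by simp
    ultimately have "(1 - (norm x)\<^sup>2) * (1 - (norm y)\<^sup>2) \<le> (1 - norm x * norm y)\<^sup>2"
      by linarith
    then show ?thesis by (simp add: power2_norm_eq_inner)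
  qed
  also have "\<dots> \<le> (1 - x \<bullet> y)\<^sup>2"
    using xy n1 by (intro power_mono) auto
  finally have "sqrt ((1 - x \<bullet> x) * (1 - y \<bullet> y)) \<le> 1 - x \<bullet> y"
    using xy n1 by (intro real_le_lsqrt) auto
  moreover have "sqrt ((1 - x \<bullet> x) * (1 - y \<bullet> y)) > 0" using nx ny by simp
  moreover have "- lorentz (hyperboloid_point x) (hyperboloid_point y)
      = (1 - x \<bullet> y) / sqrt ((1 - x \<bullet> x) * (1 - y \<bullet> y))"
    by (simp add: hyperboloid_point_def lorentz_def real_sqrt_mult diff_divide_distrib)
  ultimately show ?thesis by simp
qed

lemma hdist_eq_arcosh_lorentz:
  assumes "x \<in> H3" "y \<in> H3"
  shows "hdist x y = arcosh (- lorentz (hyperboloid_point x) (hyperboloid_point y))"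
proof -
  have "lorentz (x, 1) (x, 1) * lorentz (y, 1) (y, 1) = (1 - x \<bullet> x) * (1 - y \<bullet> y)"
    by (simp add: lorentz_def algebra_simps)
  then show ?thesis
    unfolding hdist_def hyperboloid_point_def
    by (simp add: lorentz_def real_sqrt_mult diff_divide_distrib mult.commute)
qed

lemma isometry_lorentz:
  assumes f: "isometry f" and x: "x \<in> H3" and y: "y \<in> H3"
  shows "lorentz (hyperboloid_point (f x)) (hyperboloid_point (f y))
    = lorentz (hyperboloid_point x) (hyperboloid_point y)"
proof -
  have fx: "f x \<in> H3" and fy: "f y \<in> H3"
    using f x y Bij_imp_funcset unfolding isometry_def by blast+
  have "hdist (f x) (f y) = hdist x y"
    using f x y by (auto simp: isometry_def)
  then have "cosh (hdist (f x) (f y)) = cosh (hdist x y)"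
    by simp
  then show ?thesis
    using lorentz_hyperboloid_ge_1[OF x y] lorentz_hyperboloid_ge_1[OF fx fy]
    by (simp add: hdist_eq_arcosh_lorentz x y fx fy)
qed

text \<open>
  A point \<open>y\<close> between \<open>x\<close> and \<open>z\<close> is, on the hyperboloid, a positive combination
  \<open>\<alpha> x + \<beta> z\<close>. For the images, the vector \<open>f y - \<alpha> f x - \<beta> f z\<close> has the same
  Lorentz products as \<open>y - \<alpha> x - \<beta> z = 0\<close>: it is null and orthogonal to the timelike
  \<open>f x\<close>, so it vanishes.
\<close>

lemma isometry_open_segment:
  assumes f: "isometry f" and x: "x \<in> H3" and z: "z \<in> H3" and y: "y \<in> open_segment x z"
  shows "f y \<in> open_segment (f x) (f z)"
proof -
  let ?h = hyperboloid_point
  have xz: "x \<noteq> z" using y by auto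
  have "convex H3" by (simp add: H3_def)
  then have yH: "y \<in> H3"
    using x z y by (meson convex_contains_open_segment subsetD)
  have fH: "f x \<in> H3" "f y \<in> H3" "f z \<in> H3"
    using f x yH z Bij_imp_funcset unfolding isometry_def by blast+
  have fxz: "f x \<noteq> f z"
    using f x z xz unfolding isometry_def Bij_def bij_betw_def inj_on_def by auto
  obtain t where t: "0 < t" "t < 1" and yt: "y = (1 - t) *\<^sub>R x + t *\<^sub>R z"
    using y by (auto simp: in_segment)
  define p q r where "p = snd (?h x)" and "q = snd (?h y)" and "r = snd (?h z)"
  have pos: "p > 0" "q > 0" "r > 0"
    using snd_hyperboloid_point_pos x yH z by (auto simp: p_def q_def r_def)
  define \<alpha> \<beta> where "\<alpha> = (1 - t) * q / p" and "\<beta> = t * q / r"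
  have ab: "\<alpha> > 0" "\<beta> > 0" using t pos by (auto simp: \<alpha>_def \<beta>_def)
  have hx: "?h x = p *\<^sub>R (x, 1)" and hy: "?h y = q *\<^sub>R (y, 1)" and hz: "?h z = r *\<^sub>R (z, 1)"
    using hyperboloid_point_eq p_def q_def r_def by metis+
  have combination: "\<alpha> * p = q - q * t" "\<beta> * r = q * t"
    using pos by (auto simp: \<alpha>_def \<beta>_def field_simps)
  have zero: "?h y - \<alpha> *\<^sub>R ?h x - \<beta> *\<^sub>R ?h z = 0"
    unfolding hx hy hz scaleR_scaleR combination by (simp add: yt zero_prod_def algebra_simps)
  define s where "s = ?h (f y) - \<alpha> *\<^sub>R ?h (f x) - \<beta> *\<^sub>R ?h (f z)"
  note L = isometry_lorentz[OF f]
  have "lorentz s (?h (f x)) = lorentz (?h y - \<alpha> *\<^sub>R ?h x - \<beta> *\<^sub>R ?h z) (?h x)"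
    unfolding s_def by (simp add: lorentz_bilinear L x yH z)
  also have "\<dots> = 0" by (simp add: zero lorentz_def)
  finally have "snd (?h (f x)) * lorentz s (f x, 1) = 0"
    by (metis hyperboloid_point_eq lorentz_scaleR_right)
  then have orth: "lorentz s (f x, 1) = 0"
    using snd_hyperboloid_point_pos[OF fH(1)] by simp
  have "lorentz s s = lorentz (?h y - \<alpha> *\<^sub>R ?h x - \<beta> *\<^sub>R ?h z) (?h y - \<alpha> *\<^sub>R ?h x - \<beta> *\<^sub>R ?h z)"
    unfolding s_def by (simp add: lorentz_bilinear L x yH z)
  also have "\<dots> = 0" by (simp add: zero lorentz_def)
  finally have "s = 0"
    using lorentz_orthogonal_point_nonneg(2)[OF fH(1) orth] by simp
  then have eq: "?h (f y) = \<alpha> *\<^sub>R ?h (f x) + \<beta> *\<^sub>R ?h (f z)"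
    by (simp add: s_def algebra_simps)
  define p' q' r' where "p' = snd (?h (f x))" and "q' = snd (?h (f y))" and "r' = snd (?h (f z))"
  have pos': "p' > 0" "q' > 0" "r' > 0"
    using snd_hyperboloid_point_pos fH by (auto simp: p'_def q'_def r'_def)
  have "q' *\<^sub>R (f y, 1 :: real) = \<alpha> *\<^sub>R p' *\<^sub>R (f x, 1) + \<beta> *\<^sub>R r' *\<^sub>R (f z, 1)"
    using eq hyperboloid_point_eq p'_def q'_def r'_def by metis
  then have q': "q' = \<alpha> * p' + \<beta> * r'"
    and fy: "q' *\<^sub>R f y = (\<alpha> * p') *\<^sub>R f x + (\<beta> * r') *\<^sub>R f z"
    by auto
  define u where "u = \<beta> * r' / q'"
  have one_minus_u: "1 - u = \<alpha> * p' / q'"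
    using pos' q' by (simp add: u_def field_simps)
  have u: "0 < u" "u < 1"
  proof -
    show "0 < u" using ab pos' by (simp add: u_def)
    have "0 < 1 - u" unfolding one_minus_u using ab pos' by simp
    then show "u < 1" by simp
  qed
  have "f y = (1 / q') *\<^sub>R (q' *\<^sub>R f y)" using pos' by simp
  also have "\<dots> = (1 - u) *\<^sub>R f x + u *\<^sub>R f z"
    unfolding fy one_minus_u by (simp add: u_def scaleR_add_right)
  finally show ?thesis
    using u fxz by (auto simp: in_segment)
qed

text \<open>
  Faces and one-dimensional convex sets are described by open segments alone, so they are transported
  by segment-preserving bijections. The map \<open>g\<close> has to invert \<open>f\<close> on the convex hull
  of \<open>f ` S\<close>, because the convexity of \<open>f ` e\<close> concerns points of segments that are not known
  beforehand to be images.
\<close>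

lemma face_of_image_segment_preserving:
  fixes f g :: "'a::euclidean_space \<Rightarrow> 'a"
  assumes f: "\<And>x y z. \<lbrakk>x \<in> S; z \<in> S; y \<in> open_segment x z\<rbrakk> \<Longrightarrow> f y \<in> open_segment (f x) (f z)"
    and g: "\<And>x y z. \<lbrakk>x \<in> f ` S; z \<in> f ` S; y \<in> open_segment x z\<rbrakk> \<Longrightarrow> g y \<in> open_segment (g x) (g z)"
    and gf: "\<And>x. x \<in> S \<Longrightarrow> g (f x) = x"
    and fg: "\<And>y. y \<in> convex hull (f ` S) \<Longrightarrow> f (g y) = y"
    and e: "e face_of S"
  shows "f ` e face_of f ` S"
  unfolding face_of_def
proof (intro conjI ballI impI)
  have eS: "e \<subseteq> S" using e face_of_imp_subset by blast
  show "f ` e \<subseteq> f ` S" using eS by blast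
  show "convex (f ` e)"
    unfolding convex_contains_open_segment
  proof (intro ballI subsetI)
    fix a b y assume ab: "a \<in> f ` e" "b \<in> f ` e" and y: "y \<in> open_segment a b"
    obtain a' b' where a': "a' \<in> e" "a = f a'" and b': "b' \<in> e" "b = f b'" using ab by blast
    have "g y \<in> open_segment (g a) (g b)" using g ab y eS by blast
    moreover have "g a = a'" "g b = b'" using gf a' b' eS by auto
    ultimately have "g y \<in> open_segment a' b'" by simp
    then have "g y \<in> e"
      using face_of_imp_convex[OF e] a' b' by (meson convex_contains_open_segment subsetD)
    moreover have "y \<in> convex hull (f ` S)"
    proof -
      have "a \<in> convex hull (f ` S)" "b \<in> convex hull (f ` S)"
        using ab eS by (meson hull_inc image_mono subsetD)+
      then show ?thesis
        using y convex_convex_hull[of "f ` S"] by (meson convex_contains_open_segment subsetD)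
    qed
    ultimately show "y \<in> f ` e" using fg by force
  qed
next
  fix a b x
  assume a: "a \<in> f ` S" and b: "b \<in> f ` S" and x: "x \<in> f ` e" "x \<in> open_segment a b"
  obtain a' b' x' where *: "a' \<in> S" "a = f a'" "b' \<in> S" "b = f b'" "x' \<in> e" "x = f x'"
    using a b x by blast
  have "x' \<in> S" using * e face_of_imp_subset by blast
  then have "x' \<in> open_segment a' b'" using g[OF a b x(2)] gf * by auto
  then show "a \<in> f ` e" "b \<in> f ` e"
    using face_ofD[OF e, of x' a' b'] * by auto
qed

lemma aff_dim_1_image_segment_preserving:
  fixes f :: "'a::euclidean_space \<Rightarrow> 'a"
  assumes f: "\<And>x y z. \<lbrakk>x \<in> e; z \<in> e; y \<in> open_segment x z\<rbrakk> \<Longrightarrow> f y \<in> open_segment (f x) (f z)"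
    and inj: "inj_on f e" and dim: "aff_dim e = 1"
  shows "aff_dim (f ` e) = 1"
proof -
  have "e \<noteq> {}" using dim by auto
  then obtain a where a: "a \<in> e" by blast
  have "e \<noteq> {a}" using dim by auto
  then obtain b where b: "b \<in> e" "a \<noteq> b" using a by blast
  have fab: "f a \<noteq> f b" using inj a b by (auto dest: inj_onD)
  have between_image: "between (f x, f z) (f y)" if "x \<in> e" "z \<in> e" "between (x, z) y" for x y z
    using that f[of x z y]
    by (auto simp: between_mem_segment closed_segment_eq_open)
  have "f c \<in> affine hull {f a, f b}" if c: "c \<in> e" for c
  proof -
    have "collinear {a, b, c}"
      using dim collinear_aff_dim[of e] a b c by (auto intro: collinear_subset)
    then have "collinear {f a, f b, f c}"
      unfolding collinear_between_cases using a b c between_image by blast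
    then show ?thesis using fab collinear_3_affine_hull by blast
  qed
  then have "f ` e \<subseteq> affine hull {f a, f b}" by blast
  then have "aff_dim (f ` e) \<le> aff_dim {f a, f b}"
    by (metis aff_dim_affine_hull aff_dim_subset)
  moreover have "aff_dim {f a, f b} \<le> aff_dim (f ` e)"
    using a b by (intro aff_dim_subset) auto
  ultimately show ?thesis using fab by (simp add: aff_dim_2)
qed

section \<open>Faces of a polyhedron cut by an open convex set\<close>

text \<open>
  The face of \<open>Q\<close> that induces \<open>F\<close> is the smallest one containing a relative interior point
  \<open>x\<close> of \<open>F\<close>. Minimality puts \<open>x\<close> in its relative interior too, and a face that meets the relative
  interior of a subset contains that subset; this gives both inclusions.
\<close>

lemma face_of_polyhedron_Int_open:
  fixes Q :: "'a::euclidean_space set"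
  assumes Q: "polyhedron Q" and B: "open B" "convex B"
    and F: "F face_of Q \<inter> B" "F \<noteq> {}"
  obtains F' where "F' face_of Q" "F = F' \<inter> B" "aff_dim F' = aff_dim F"
proof -
  obtain x where x: "x \<in> rel_interior F"
    using F face_of_imp_convex rel_interior_eq_empty by blast
  have xF: "x \<in> F" using x rel_interior_subset by blast
  have FQB: "F \<subseteq> Q \<inter> B" using F face_of_imp_subset by blast
  have cQ: "convex Q" using Q polyhedron_imp_convex by blast
  define F' where "F' = \<Inter>{T. T face_of Q \<and> x \<in> T}"
  have F'face: "F' face_of Q"
    unfolding F'_def using xF FQB face_of_refl[OF cQ] by (intro face_of_Inter) auto
  have xF': "x \<in> F'" by (simp add: F'_def)
  have cF': "convex F'" using F'face face_of_imp_convex by blast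
  have polF': "polyhedron F'" using Q F'face face_of_polyhedron_polyhedron by blast
  have "x \<notin> T" if T: "T facet_of F'" for T
  proof
    assume "x \<in> T"
    moreover have "T face_of Q"
      using T F'face face_of_trans facet_of_imp_face_of by blast
    ultimately have "F' \<subseteq> T" by (auto simp: F'_def)
    then show False using T facet_of_imp_subset facet_of_irrefl by (metis subset_antisym)
  qed
  then have xr: "x \<in> rel_interior F'"
    using rel_interior_of_polyhedron[OF polF'] xF' by blast
  have "F \<subseteq> F'" using subset_of_face_of[OF F'face] FQB x xF' by blast
  moreover have "F' \<inter> B \<subseteq> F"
  proof (rule subset_of_face_of[OF F(1)])
    show "F' \<inter> B \<subseteq> Q \<inter> B" using F'face face_of_imp_subset by blast
    have "rel_interior (F' \<inter> B) = rel_interior F' \<inter> rel_interior B"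
      using xr xF FQB B rel_interior_open[OF B(1)]
      by (intro convex_rel_interior_inter_two cF') auto
    then show "F \<inter> rel_interior (F' \<inter> B) \<noteq> {}"
      using xr xF FQB rel_interior_open[OF B(1)] by auto
  qed
  ultimately have eq: "F = F' \<inter> B" using FQB by blast
  have "aff_dim F' = aff_dim F"
    unfolding eq using aff_dim_convex_Int_open[OF cF' B(1)] eq F(2) by simp
  then show thesis using that F'face eq by blast
qed

lemma finite_faces_polyhedron_Int_open:
  fixes Q :: "'a::euclidean_space set"
  assumes "polyhedron Q" "open B" "convex B"
  shows "finite {F. F face_of Q \<inter> B}"
proof (rule finite_subset)
  show "{F. F face_of Q \<inter> B} \<subseteq> insert {} ((\<lambda>F. F \<inter> B) ` {F. F face_of Q})"
    using face_of_polyhedron_Int_open[OF assms] by blast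
  show "finite (insert {} ((\<lambda>F. F \<inter> B) ` {F. F face_of Q}))"
    using finite_polyhedron_faces assms(1) by blast
qed

lemma facet_of_polyhedron_Int_open:
  fixes Q :: "'a::euclidean_space set"
  assumes Q: "polyhedron Q" and B: "open B" "convex B"
    and F: "F facet_of Q \<inter> B"
  obtains F' where "F' facet_of Q" "F = F' \<inter> B"
proof -
  have Fface: "F face_of Q \<inter> B" "F \<noteq> {}" and dF: "aff_dim F = aff_dim (Q \<inter> B) - 1"
    using F by (auto simp: facet_of_def)
  obtain F' where F': "F' face_of Q" "F = F' \<inter> B" "aff_dim F' = aff_dim F"
    using face_of_polyhedron_Int_open[OF Q B Fface] .
  have "Q \<inter> B \<noteq> {}" using Fface face_of_imp_subset by blast
  then have "aff_dim (Q \<inter> B) = aff_dim Q"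
    using aff_dim_convex_Int_open B Q polyhedron_imp_convex by blast
  then show thesis using that F' dF Fface(2) by (auto simp: facet_of_def)
qed

text \<open>
  The corresponding fact for \<open>Q\<close> is cut down to \<open>B\<close>. Facets of \<open>Q\<close> that contain the face inducing
  \<open>F\<close> meet \<open>B\<close>, so they keep their dimension and cut out facets of \<open>Q \<inter> B\<close>.
\<close>

lemma face_eq_Inter_facets_polyhedron_Int_open:
  fixes Q :: "'a::euclidean_space set"
  assumes Q: "polyhedron Q" and B: "open B" "convex B"
    and F: "F face_of Q \<inter> B" "F \<noteq> {}" "F \<noteq> Q \<inter> B"
  shows "F = \<Inter>{T. T facet_of Q \<inter> B \<and> F \<subseteq> T}"
proof
  show "F \<subseteq> \<Inter>{T. T facet_of Q \<inter> B \<and> F \<subseteq> T}" by blast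
  obtain F' where F': "F' face_of Q" "F = F' \<inter> B"
    using face_of_polyhedron_Int_open[OF Q B F(1,2)] .
  have FQB: "F \<subseteq> Q \<inter> B" using F face_of_imp_subset by blast
  have dQB: "aff_dim (Q \<inter> B) = aff_dim Q"
    using aff_dim_convex_Int_open[of Q B] B Q polyhedron_imp_convex FQB F(2) by blast
  have "F' \<noteq> {}" "F' \<noteq> Q" using F' F by auto
  note F'eq = face_of_polyhedron[OF Q F'(1) this]
  have facet: "T \<inter> B facet_of Q \<inter> B" if T: "T facet_of Q" "F' \<subseteq> T" for T
  proof -
    have ne: "T \<inter> B \<noteq> {}" using T F' F by blast
    have "convex T" using T facet_of_imp_face_of face_of_imp_convex by blast
    then have "aff_dim (T \<inter> B) = aff_dim T" using aff_dim_convex_Int_open B ne by blast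
    then show ?thesis
      using T ne dQB face_of_slice[OF _ B(2)] by (auto simp: facet_of_def)
  qed
  obtain T0 where T0: "T0 facet_of Q" "F' \<subseteq> T0"
    using face_of_polyhedron_subset_facet[OF Q F'(1) \<open>F' \<noteq> {}\<close> \<open>F' \<noteq> Q\<close>] .
  show "\<Inter>{T. T facet_of Q \<inter> B \<and> F \<subseteq> T} \<subseteq> F"
  proof
    fix x assume x: "x \<in> \<Inter>{T. T facet_of Q \<inter> B \<and> F \<subseteq> T}"
    have *: "x \<in> T \<inter> B" if "T facet_of Q" "F' \<subseteq> T" for T
      using x facet[OF that] F'(2) that(2) by blast
    have "x \<in> F'" by (subst F'eq) (use * in blast)
    then show "x \<in> F" using *[OF T0] F'(2) by blast
  qed
qed

section \<open>Outer normals and the faces at an edge\<close>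

lemma convex_polyhedronE:
  assumes "convex_polyhedron P"
  obtains Q where "polyhedron Q" "P = Q \<inter> H3" "convex P" "aff_dim P = 3" "open H3" "convex H3"
proof -
  obtain Q where Q: "polyhedron Q" "P = Q \<inter> H3" and int: "interior P \<noteq> {}"
    using assms unfolding convex_polyhedron_def by blast
  have H: "open H3" "convex H3" by (auto simp: H3_def)
  have "convex P" using Q H by (simp add: polyhedron_imp_convex convex_Int)
  moreover have "aff_dim P = 3"
    using aff_dim_nonempty_interior[OF int] by simp
  ultimately show thesis using that[OF Q] H by simp
qed

lemma outer_unit_normal_exists:
  assumes P: "convex_polyhedron P" and F: "F facet_of P"
  shows "\<exists>m. outer_unit_normal P F m"
proof -
  obtain Q where Q: "polyhedron Q" "P = Q \<inter> H3" and H: "open H3" "convex H3"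
    using convex_polyhedronE[OF P] by metis
  obtain F' where F': "F' facet_of Q" "F = F' \<inter> H3"
    using facet_of_polyhedron_Int_open[OF Q(1) H] F Q(2) by metis
  obtain a b where a: "a \<noteq> 0" and le: "Q \<subseteq> {x. a \<bullet> x \<le> b}" and eq: "F' = Q \<inter> {x. a \<bullet> x = b}"
    using facet_of_polyhedron[OF Q(1) F'(1)] .
  obtain x where x: "x \<in> F" using F by (auto simp: facet_of_def)
  then have "a \<bullet> x = b" "x \<in> H3" using F' eq by auto
  \<comment> \<open>The plane passes through a point of the ball, so its normal is spacelike.\<close>
  then have "lorentz (a, b) (a, b) > 0"
    using lorentz_orthogonal_point_nonneg[of x "(a, b)"] a
    by (force simp: lorentz_point zero_prod_def)
  define c where "c = 1 / sqrt (lorentz (a, b) (a, b))"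
  have c: "c > 0" "c * c * lorentz (a, b) (a, b) = 1"
    using \<open>lorentz (a, b) (a, b) > 0\<close> by (auto simp: c_def)
  have pt: "lorentz (c *\<^sub>R (a, b)) (x, 1) = c * (a \<bullet> x - b)" for x
    by (simp add: lorentz_point algebra_simps)
  have "outer_unit_normal P F (c *\<^sub>R (a, b))"
    unfolding outer_unit_normal_def
  proof (intro conjI ballI)
    show "lorentz (c *\<^sub>R (a, b)) (c *\<^sub>R (a, b)) = 1"
      using c(2) unfolding lorentz_scaleR_left lorentz_scaleR_right by simp
    show "lorentz (c *\<^sub>R (a, b)) (x, 1) \<le> 0" if "x \<in> P" for x
      using le that Q(2) c(1) unfolding pt by (auto simp: mult_le_0_iff)
    show "F = {x \<in> P. lorentz (c *\<^sub>R (a, b)) (x, 1) = 0}"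
      using F'(2) eq Q(2) c(1) unfolding pt by auto
  qed
  then show ?thesis by blast
qed

lemma lorentz_functional_zero:
  fixes S :: "point set"
  assumes "aff_dim S = 3" and "\<And>x. x \<in> S \<Longrightarrow> lorentz m (x, 1) = 0"
  shows "m = 0"
proof -
  have "S \<subseteq> {x. fst m \<bullet> x = snd m}" using assms(2) by (auto simp: lorentz_point)
  then have "affine hull S \<subseteq> {x. fst m \<bullet> x = snd m}"
    by (intro hull_minimal) (auto simp: affine_hyperplane)
  moreover have "affine hull S = UNIV" using assms(1) aff_dim_eq_full[of S] by simp
  ultimately have *: "fst m \<bullet> x = snd m" for x by auto
  have "snd m = 0" using *[of 0] by simp
  moreover have "fst m = 0" using *[of "fst m"] calculation by simp
  ultimately show ?thesis by (simp add: prod_eq_iff)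
qed

lemma aff_dim_insert_face:
  fixes S :: "'a::euclidean_space set"
  assumes "convex S" "T face_of S" "x \<in> S - T"
  shows "aff_dim (insert x T) = aff_dim T + 1"
  using assms face_of_imp_eq_affine_Int[of S T] by (auto simp: aff_dim_insert)

text \<open>
  A Lorentz functional is determined by its values on the spanning set made of a facet and one
  further point of \<open>P\<close>. Two normals of the same facet are thus proportional, and the
  normalisations fix the factor.
\<close>

lemma outer_unit_normal_unique:
  assumes P: "convex_polyhedron P" and F: "F facet_of P"
    and m: "outer_unit_normal P F m" and m': "outer_unit_normal P F m'"
  shows "m = m'"
proof -
  obtain cP: "convex P" and dP: "aff_dim P = 3" using convex_polyhedronE[OF P] by metis
  have Fface: "F face_of P" and dF: "aff_dim F = 2" using F dP by (auto simp: facet_of_def)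
  have "F \<subset> P" using F facet_of_imp_subset facet_of_irrefl by blast
  then obtain p where p: "p \<in> P - F" by blast
  define k where "k = lorentz m (p, 1) / lorentz m' (p, 1)"
  have "lorentz m (p, 1) \<le> 0" "lorentz m (p, 1) \<noteq> 0" "lorentz m' (p, 1) \<le> 0" "lorentz m' (p, 1) \<noteq> 0"
    using p m m' unfolding outer_unit_normal_def by blast+
  then have neg: "lorentz m (p, 1) < 0" "lorentz m' (p, 1) < 0" by auto
  then have k: "k > 0" by (simp add: k_def divide_neg_neg)
  have "m - k *\<^sub>R m' = 0"
  proof (rule lorentz_functional_zero)
    show "aff_dim (insert p F) = 3" using aff_dim_insert_face[OF cP Fface p] dF by simp
    fix x assume "x \<in> insert p F"
    then show "lorentz (m - k *\<^sub>R m') (x, 1) = 0"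
    proof
      assume "x = p" then show ?thesis using neg by (simp add: lorentz_bilinear k_def)
    next
      assume "x \<in> F"
      then have "lorentz m (x, 1) = 0" "lorentz m' (x, 1) = 0"
        using m m' unfolding outer_unit_normal_def by blast+
      then show ?thesis by (simp add: lorentz_bilinear)
    qed
  qed
  then have mk: "m = k *\<^sub>R m'" by simp
  then have "1 = k * k"
    using m m' unfolding outer_unit_normal_def by (simp add: lorentz_bilinear)
  then have "k = 1" using k by (metis power2_eq_1_iff power2_eq_square zero_less_one
        not_less_iff_gr_or_eq neg_0_less_iff_less less_trans)
  then show ?thesis using mk by simp
qed

lemma facet_subset_imp_eq:
  assumes "convex P" "F facet_of P" "F' facet_of P" "F \<subseteq> F'"
  shows "F = F'"
proof (rule ccontr)
  assume "F \<noteq> F'"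
  moreover have "F face_of F'"
    using assms by (meson face_of_subset facet_of_imp_face_of facet_of_imp_subset)
  moreover have "convex F'" using assms facet_of_imp_face_of face_of_imp_convex by blast
  ultimately show False
    using face_of_aff_dim_lt[of F' F] assms by (simp add: facet_of_def)
qed

text \<open>
  The Lorentz functionals that vanish on an edge form a plane, so the outer normals \<open>l\<close>, \<open>m\<close>, \<open>n\<close> of
  facets \<open>F\<close>, \<open>G\<close>, \<open>G'\<close> through the edge are linearly dependent. Evaluation at a point of \<open>F\<close> off the
  edge shows that the relation has the form \<open>b n = c m + s l\<close> with \<open>b, c > 0\<close>. All
  three functionals are nonpositive on \<open>P\<close>. So a zero of \<open>n\<close> on \<open>P\<close> is a zero of
  \<open>m\<close> if \<open>s \<ge> 0\<close>, and conversely if \<open>s < 0\<close>: one of \<open>G\<close>, \<open>G'\<close> contains the other.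
\<close>

lemma no_third_facet_at_edge:
  assumes P: "convex_polyhedron P" and e: "e edge_of P"
    and F: "F facet_of P" "e \<subseteq> F" and G: "G facet_of P" "e \<subseteq> G" "G \<noteq> F"
    and G': "G' facet_of P" "e \<subseteq> G'" "G' \<noteq> F"
  shows "G = G'"
proof -
  obtain cP: "convex P" and dP: "aff_dim P = 3" using convex_polyhedronE[OF P] by metis
  have Fface: "F face_of P" and dF: "aff_dim F = 2" using F dP by (auto simp: facet_of_def)
  have eface: "e face_of P" and de: "aff_dim e = 1" using e by (auto simp: edge_of_def)
  obtain l m n where l: "outer_unit_normal P F l" and m: "outer_unit_normal P G m"
    and n: "outer_unit_normal P G' n"
    using outer_unit_normal_exists[OF P] F G G' by metis
  have "F \<subset> P" using F facet_of_imp_subset facet_of_irrefl by blast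
  then obtain p where p: "p \<in> P - F" by blast
  have "e \<noteq> F" using de dF by auto
  then obtain q where q: "q \<in> F" "q \<notin> e" using F by blast
  have qP: "q \<in> P" using q F facet_of_imp_subset by blast
  have de': "aff_dim (insert q e) = 2"
    using aff_dim_insert_face[OF cP eface] q qP de by simp
  have hull: "affine hull (insert q e) = affine hull F"
    using aff_dim_eq_full_gen[of "insert q e" F] de' dF F q by auto
  then have "p \<notin> affine hull (insert q e)"
    using face_of_imp_eq_affine_Int[OF cP Fface] p by blast
  then have span: "aff_dim (insert p (insert q e)) = 3" using de' by (simp add: aff_dim_insert)
  have le: "lorentz l (x, 1) \<le> 0" "lorentz m (x, 1) \<le> 0" "lorentz n (x, 1) \<le> 0" if "x \<in> P" for x
    using that l m n unfolding outer_unit_normal_def by blast+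
  have Feq: "F = {x \<in> P. lorentz l (x, 1) = 0}" and Geq: "G = {x \<in> P. lorentz m (x, 1) = 0}"
    and G'eq: "G' = {x \<in> P. lorentz n (x, 1) = 0}"
    using l m n unfolding outer_unit_normal_def by blast+
  have on_e: "lorentz l (x, 1) = 0" "lorentz m (x, 1) = 0" "lorentz n (x, 1) = 0" if "x \<in> e" for x
    using that F G G' Feq Geq G'eq by blast+
  have lq: "lorentz l (q, 1) = 0" using q Feq by blast
  have lp: "lorentz l (p, 1) < 0" using p Feq le by force
  \<comment> \<open>A facet through the edge and the point \<open>q\<close> would contain all of \<open>F\<close>.\<close>
  have off: "q \<notin> T" if T: "T facet_of P" "e \<subseteq> T" "T \<noteq> F" for T
  proof
    assume "q \<in> T"
    then have "affine hull F \<subseteq> affine hull T" using hull T(2) by (metis hull_mono insert_subset)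
    then have "F \<subseteq> T"
      using face_of_imp_eq_affine_Int[OF cP facet_of_imp_face_of[OF T(1)]] F
        hull_subset[of F affine] facet_of_imp_subset by blast
    then show False using facet_subset_imp_eq[OF cP F(1) T(1)] T(3) by simp
  qed
  define b c where "b = - lorentz m (q, 1)" and "c = - lorentz n (q, 1)"
  have b: "b > 0" using off[OF G] qP Geq le(2)[OF qP] by (auto simp: b_def)
  have c: "c > 0" using off[OF G'] qP G'eq le(3)[OF qP] by (auto simp: c_def)
  define s where "s = (b * lorentz n (p, 1) - c * lorentz m (p, 1)) / lorentz l (p, 1)"
  have dependent: "b *\<^sub>R n - c *\<^sub>R m - s *\<^sub>R l = 0"
  proof (rule lorentz_functional_zero[OF span])
    fix x assume "x \<in> insert p (insert q e)"
    then consider "x = p" | "x = q" | "x \<in> e" by blast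
    then show "lorentz (b *\<^sub>R n - c *\<^sub>R m - s *\<^sub>R l) (x, 1) = 0"
    proof cases
      case 1
      have "s * lorentz l (p, 1) = b * lorentz n (p, 1) - c * lorentz m (p, 1)"
        using lp by (simp add: s_def)
      then show ?thesis unfolding lorentz_bilinear 1 by linarith
    next
      case 2
      show ?thesis unfolding lorentz_bilinear 2 lq by (simp add: b_def c_def)
    next
      case 3
      show ?thesis unfolding lorentz_bilinear on_e[OF 3] by simp
    qed
  qed
  have rel: "b * lorentz n (x, 1) = c * lorentz m (x, 1) + s * lorentz l (x, 1)" for x
  proof -
    have "lorentz (b *\<^sub>R n - c *\<^sub>R m - s *\<^sub>R l) (x, 1) = 0"
      unfolding dependent by (simp add: lorentz_point)
    then show ?thesis by (simp add: lorentz_bilinear)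
  qed
  show ?thesis
  proof (cases "s \<ge> 0")
    case True
    have "x \<in> G" if x: "x \<in> G'" for x
    proof -
      have xP: "x \<in> P" and "lorentz n (x, 1) = 0" using x G'eq by auto
      then have "c * lorentz m (x, 1) = - (s * lorentz l (x, 1))" using rel[of x] by simp
      moreover have "s * lorentz l (x, 1) \<le> 0" using True le(1)[OF xP] by (simp add: mult_nonneg_nonpos)
      ultimately have "c * lorentz m (x, 1) \<ge> 0" by linarith
      then have "lorentz m (x, 1) \<ge> 0" using c by (simp add: zero_le_mult_iff)
      then show ?thesis using le(2)[OF xP] xP Geq by auto
    qed
    then show ?thesis using facet_subset_imp_eq[OF cP G'(1) G(1)] by blast
  next
    case False
    have "x \<in> G'" if x: "x \<in> G" for x
    proof -
      have xP: "x \<in> P" and "lorentz m (x, 1) = 0" using x Geq by auto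
      then have "b * lorentz n (x, 1) = s * lorentz l (x, 1)" using rel[of x] by simp
      moreover have "s * lorentz l (x, 1) \<ge> 0" using False le(1)[OF xP] by (simp add: mult_nonpos_nonpos)
      ultimately have "b * lorentz n (x, 1) \<ge> 0" by linarith
      then have "lorentz n (x, 1) \<ge> 0" using b by (simp add: zero_le_mult_iff)
      then show ?thesis using le(3)[OF xP] xP G'eq by auto
    qed
    then show ?thesis using facet_subset_imp_eq[OF cP G(1) G'(1)] by blast
  qed
qed

text \<open>
  An edge is the intersection of the facets through it, and a single facet has too large a dimension.
\<close>

lemma edge_in_two_facets:
  assumes P: "convex_polyhedron P" and e: "e edge_of P"
  shows "\<exists>F G. F \<noteq> G \<and> (\<forall>T. T facet_of P \<and> e \<subseteq> T \<longleftrightarrow> T = F \<or> T = G)"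
proof -
  obtain Q where Q: "polyhedron Q" "P = Q \<inter> H3" and H: "open H3" "convex H3"
    and dP: "aff_dim P = 3"
    using convex_polyhedronE[OF P] by metis
  have e': "e face_of Q \<inter> H3" "e \<noteq> {}" "e \<noteq> Q \<inter> H3" and de: "aff_dim e = 1"
    using e dP Q(2) by (auto simp: edge_of_def)
  have Inter: "e = \<Inter>{T. T facet_of P \<and> e \<subseteq> T}"
    using face_eq_Inter_facets_polyhedron_Int_open[OF Q(1) H e'] Q(2) by simp
  have "{T. T facet_of P \<and> e \<subseteq> T} \<noteq> {}"
  proof
    assume "{T. T facet_of P \<and> e \<subseteq> T} = {}"
    then have "e = UNIV" using Inter by (metis Inter_empty)
    then show False using de by simp
  qed
  then obtain F where F: "F facet_of P" "e \<subseteq> F" by blast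
  have "aff_dim F = 2" using F dP by (simp add: facet_of_def)
  then have "{T. T facet_of P \<and> e \<subseteq> T} \<noteq> {F}" using Inter de by (metis cInf_singleton one_eq_numeral_iff semiring_norm(85))
  then obtain G where G: "G facet_of P" "e \<subseteq> G" "G \<noteq> F" using F by blast
  have "\<forall>T. T facet_of P \<and> e \<subseteq> T \<longleftrightarrow> T = F \<or> T = G"
    using no_third_facet_at_edge[OF P e F G] F G by blast
  then show ?thesis using G(3) by metis
qed

text \<open>
  The defining description determines the angle only because the pair of facets and their normals are
  unique. Both normals are orthogonal to a point of the edge, hence span a semidefinite subspace, where
  the Cauchy-Schwarz inequality puts their product into the domain of \<open>arccos\<close>.
\<close>

lemma dihedral_angle_le_pi:
  assumes P: "convex_polyhedron P" and e: "e edge_of P"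
  shows "dihedral_angle P e \<le> pi"
proof -
  obtain F G where FG: "F \<noteq> G" "\<forall>T. T facet_of P \<and> e \<subseteq> T \<longleftrightarrow> T = F \<or> T = G"
    using edge_in_two_facets[OF P e] by blast
  have F: "F facet_of P" "e \<subseteq> F" and G: "G facet_of P" "e \<subseteq> G" using FG(2) by blast+
  obtain m n where m: "outer_unit_normal P F m" and n: "outer_unit_normal P G n"
    using outer_unit_normal_exists[OF P] F G by metis
  have "dihedral_angle P e = pi - arccos (lorentz m n)"
    unfolding dihedral_angle_def
  proof (rule the_equality)
    show "\<exists>\<sigma> \<tau> m' n'. \<sigma> facet_of P \<and> \<tau> facet_of P \<and> \<sigma> \<noteq> \<tau> \<and> e \<subseteq> \<sigma> \<and> e \<subseteq> \<tau> \<and>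
       outer_unit_normal P \<sigma> m' \<and> outer_unit_normal P \<tau> n' \<and>
       pi - arccos (lorentz m n) = pi - arccos (lorentz m' n')"
      using F G FG(1) m n by blast
  next
    fix \<theta>
    assume "\<exists>\<sigma> \<tau> m' n'. \<sigma> facet_of P \<and> \<tau> facet_of P \<and> \<sigma> \<noteq> \<tau> \<and> e \<subseteq> \<sigma> \<and> e \<subseteq> \<tau> \<and>
       outer_unit_normal P \<sigma> m' \<and> outer_unit_normal P \<tau> n' \<and> \<theta> = pi - arccos (lorentz m' n')"
    then obtain \<sigma> \<tau> m' n' where *: "\<sigma> facet_of P" "\<tau> facet_of P" "\<sigma> \<noteq> \<tau>" "e \<subseteq> \<sigma>" "e \<subseteq> \<tau>"
       "outer_unit_normal P \<sigma> m'" "outer_unit_normal P \<tau> n'" "\<theta> = pi - arccos (lorentz m' n')"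
      by blast
    have "\<sigma> \<in> {F, G}" "\<tau> \<in> {F, G}" using * FG(2) by blast+
    then consider "\<sigma> = F" "\<tau> = G" | "\<sigma> = G" "\<tau> = F" using *(3) by blast
    then show "\<theta> = pi - arccos (lorentz m n)"
    proof cases
      case 1
      then show ?thesis using * m n outer_unit_normal_unique[OF P] by metis
    next
      case 2
      then show ?thesis using * m n outer_unit_normal_unique[OF P] lorentz_commute by metis
    qed
  qed
  moreover have "\<bar>lorentz m n\<bar> \<le> 1"
  proof -
    have "e \<noteq> {}" using e by (auto simp: edge_of_def)
    then obtain x where x: "x \<in> e" by blast
    have "x \<in> H3" using x F P facet_of_imp_subset by (metis Int_iff convex_polyhedronE subsetD)
    have unit: "lorentz m m = 1" "lorentz n n = 1" and "x \<in> F" "x \<in> G"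
      using m n x F G unfolding outer_unit_normal_def by blast+
    then have orth: "lorentz m (x, 1) = 0" "lorentz n (x, 1) = 0"
      using m n unfolding outer_unit_normal_def by blast+
    have "lorentz (m + n) (x, 1) = 0" "lorentz (m - n) (x, 1) = 0"
      unfolding lorentz_bilinear orth by simp_all
    then have "lorentz (m + n) (m + n) \<ge> 0" "lorentz (m - n) (m - n) \<ge> 0"
      using lorentz_orthogonal_point_nonneg(1)[OF \<open>x \<in> H3\<close>] by blast+
    then show ?thesis using unit lorentz_commute[of m n] by (simp add: lorentz_bilinear)
  qed
  ultimately show ?thesis using arccos_lbound by (simp add: abs_le_iff)
qed

section \<open>Edge cycles of a face pairing\<close>

lemma periodic_of_inj_on_finite:
  assumes "finite S" "T ` S \<subseteq> S" "inj_on T S" "x \<in> S"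
  obtains n where "n > 0" "(T ^^ n) x = x"
proof -
  \<comment> \<open>Extended by the identity, the map is injective on the whole type.\<close>
  define T' where "T' y = (if y \<in> S then T y else y)" for y
  have "inj T'"
    using assms(2,3) unfolding T'_def inj_def by (auto dest: inj_onD)
  have iter: "(T' ^^ n) x = (T ^^ n) x \<and> (T ^^ n) x \<in> S" for n
    by (induction n) (use assms in \<open>auto simp: T'_def\<close>)
  then have "finite {y. \<exists>n. y = (T' ^^ n) x}"
    by (intro finite_subset[OF _ assms(1)]) auto
  then obtain n where "n > 0" "(T' ^^ n) x = x" using funpow_inj_finite[OF \<open>inj T'\<close>] by blast
  then show thesis using that iter by metis
qed

text \<open>The incidence properties of a face pairing on which the construction of edge cycles rests.\<close>

locale edge_face_pairing =
  fixes P :: "point set" and mate :: "point set \<Rightarrow> point set" and \<phi> :: "point set \<Rightarrow> isom"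
  assumes finite_faces: "finite {F. F face_of P}"
    and two_facets: "e edge_of P \<Longrightarrow> \<exists>F G. F \<noteq> G \<and> (\<forall>T. T facet_of P \<and> e \<subseteq> T \<longleftrightarrow> T = F \<or> T = G)"
    and mate_facet: "\<sigma> facet_of P \<Longrightarrow> mate \<sigma> facet_of P"
    and mate_neq: "\<sigma> facet_of P \<Longrightarrow> mate \<sigma> \<noteq> \<sigma>"
    and mate_mate: "\<sigma> facet_of P \<Longrightarrow> mate (mate \<sigma>) = \<sigma>"
    and image_facet: "\<sigma> facet_of P \<Longrightarrow> \<phi> \<sigma> ` \<sigma> = mate \<sigma>"
    and letter_inj: "\<lbrakk>\<sigma> facet_of P; \<tau> facet_of P; \<phi> \<sigma> = \<phi> \<tau>\<rbrakk> \<Longrightarrow> \<sigma> = \<tau>"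
    and image_edge: "\<lbrakk>\<sigma> facet_of P; e edge_of P; e \<subseteq> \<sigma>\<rbrakk> \<Longrightarrow> \<phi> \<sigma> ` e edge_of P"
    and mate_image: "\<lbrakk>\<sigma> facet_of P; e \<subseteq> \<sigma>\<rbrakk> \<Longrightarrow> \<phi> (mate \<sigma>) ` \<phi> \<sigma> ` e = e"
begin

definition flags :: "(point set \<times> point set) set" where
  "flags = {(e, \<sigma>). e edge_of P \<and> \<sigma> facet_of P \<and> e \<subseteq> \<sigma>}"

definition other_facet :: "point set \<Rightarrow> point set \<Rightarrow> point set" where
  "other_facet e \<sigma> = (THE \<tau>. \<tau> facet_of P \<and> e \<subseteq> \<tau> \<and> \<tau> \<noteq> \<sigma>)"

definition next_flag :: "point set \<times> point set \<Rightarrow> point set \<times> point set" where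
  "next_flag = (\<lambda>(e, \<sigma>). (\<phi> \<sigma> ` e, other_facet (\<phi> \<sigma> ` e) (mate \<sigma>)))"

lemma other_facet_unique:
  assumes "(e, \<sigma>) \<in> flags" "\<tau> facet_of P" "e \<subseteq> \<tau>" "\<tau> \<noteq> \<sigma>"
  shows "other_facet e \<sigma> = \<tau>"
proof -
  have "e edge_of P" using assms(1) by (simp add: flags_def)
  obtain F G where "F \<noteq> G" "\<forall>T. T facet_of P \<and> e \<subseteq> T \<longleftrightarrow> T = F \<or> T = G"
    using two_facets[OF \<open>e edge_of P\<close>] by blast
  then have FG: "T \<in> {F, G}" if "T facet_of P" "e \<subseteq> T" for T using that by blast
  have "\<sigma> \<in> {F, G}" using assms(1) FG by (simp add: flags_def)
  then have unique: "\<tau>' = \<tau>" if "\<tau>' facet_of P" "e \<subseteq> \<tau>'" "\<tau>' \<noteq> \<sigma>" for \<tau>'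
    using FG[OF that(1,2)] that(3) FG[OF assms(2,3)] assms(4) by auto
  show ?thesis
    unfolding other_facet_def
  proof (rule the_equality)
    show "\<tau> facet_of P \<and> e \<subseteq> \<tau> \<and> \<tau> \<noteq> \<sigma>" using assms by blast
  qed (use unique in blast)
qed

lemma other_facet_flag:
  assumes "(e, \<sigma>) \<in> flags"
  shows "(e, other_facet e \<sigma>) \<in> flags" "other_facet e \<sigma> \<noteq> \<sigma>"
proof -
  have "e edge_of P" using assms by (simp add: flags_def)
  obtain F G where "F \<noteq> G" "\<forall>T. T facet_of P \<and> e \<subseteq> T \<longleftrightarrow> T = F \<or> T = G"
    using two_facets[OF \<open>e edge_of P\<close>] by blast
  then have "F facet_of P" "e \<subseteq> F" "G facet_of P" "e \<subseteq> G" by blast+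
  then obtain \<tau> where "\<tau> facet_of P" "e \<subseteq> \<tau>" "\<tau> \<noteq> \<sigma>"
    using \<open>F \<noteq> G\<close> by metis
  then show "(e, other_facet e \<sigma>) \<in> flags" "other_facet e \<sigma> \<noteq> \<sigma>"
    using other_facet_unique[OF assms] assms by (auto simp: flags_def)
qed

lemma other_facet_involutive:
  assumes "(e, \<sigma>) \<in> flags"
  shows "other_facet e (other_facet e \<sigma>) = \<sigma>"
  using other_facet_flag[OF assms] other_facet_unique[of e "other_facet e \<sigma>" \<sigma>] assms
  by (auto simp: flags_def)

lemma image_flag:
  assumes "(e, \<sigma>) \<in> flags"
  shows "(\<phi> \<sigma> ` e, mate \<sigma>) \<in> flags"
proof -
  have *: "e edge_of P" "\<sigma> facet_of P" "e \<subseteq> \<sigma>" using assms by (auto simp: flags_def)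
  then have "\<phi> \<sigma> ` e \<subseteq> mate \<sigma>" using image_facet by blast
  then show ?thesis using * image_edge mate_facet by (simp add: flags_def)
qed

lemma next_flag_in: "z \<in> flags \<Longrightarrow> next_flag z \<in> flags"
  using image_flag other_facet_flag by (cases z) (auto simp: next_flag_def)

text \<open>
  A step can be undone: the partner of the face just left is the other face at the new edge.
\<close>

lemma inj_on_next_flag: "inj_on next_flag flags"
proof (rule inj_onI)
  fix z z' assume z: "z \<in> flags" "z' \<in> flags" and eq: "next_flag z = next_flag z'"
  obtain e \<sigma> e' \<sigma>' where zz: "z = (e, \<sigma>)" "z' = (e', \<sigma>')" by (cases z, cases z') auto
  have im: "\<phi> \<sigma> ` e = \<phi> \<sigma>' ` e'"
    and oth: "other_facet (\<phi> \<sigma> ` e) (mate \<sigma>) = other_facet (\<phi> \<sigma>' ` e') (mate \<sigma>')"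
    using eq zz by (auto simp: next_flag_def)
  have "mate \<sigma> = mate \<sigma>'"
    using other_facet_involutive[OF image_flag] z zz im oth by metis
  moreover have f: "\<sigma> facet_of P" "\<sigma>' facet_of P" "e \<subseteq> \<sigma>" "e' \<subseteq> \<sigma>'" using z zz by (auto simp: flags_def)
  ultimately have "\<sigma> = \<sigma>'" using mate_mate by metis
  moreover have "e = e'" using mate_image f im \<open>\<sigma> = \<sigma>'\<close> by metis
  ultimately show "z = z'" using zz by simp
qed

lemma finite_flags: "finite flags"
proof (rule finite_subset)
  show "flags \<subseteq> {F. F face_of P} \<times> {F. F face_of P}"
    by (auto simp: flags_def edge_of_def facet_of_imp_face_of)
qed (use finite_faces in blast)

text \<open>
  The flag map permutes a finite set, so every flag recurs, and the process that starts with it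
  returns to its first edge.
\<close>

lemma edge_cycle_from_flag:
  assumes z: "(e, \<sigma>) \<in> flags"
  obtains es ss where "edge_cycle P mate \<phi> es ss" "hd es = e" "hd ss = \<sigma>"
proof -
  define T where "T n = (next_flag ^^ n) (e, \<sigma>)" for n
  have T0: "T 0 = (e, \<sigma>)" and TSuc: "T (Suc n) = next_flag (T n)" for n
    by (simp_all add: T_def)
  have Tin: "T n \<in> flags" for n
    by (induction n) (use z next_flag_in T0 TSuc in auto)
  obtain N where N: "N > 0" "T N = (e, \<sigma>)"
    using periodic_of_inj_on_finite[OF finite_flags _ inj_on_next_flag z] next_flag_in
    unfolding T_def by blast
  \<comment> \<open>The cycle ends when the edge returns, which may happen before the flag does.\<close>
  define n where "n = (LEAST k. k > 0 \<and> fst (T k) = e)"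
  have n: "n > 0" "fst (T n) = e"
    using LeastI[of "\<lambda>k. k > 0 \<and> fst (T k) = e" N] N unfolding n_def by auto
  have first: "fst (T k) \<noteq> e" if "0 < k" "k < n" for k
    using not_less_Least[of k "\<lambda>k. k > 0 \<and> fst (T k) = e"] that unfolding n_def by auto
  have step: "fst (T (Suc k)) = \<phi> (snd (T k)) ` fst (T k)" for k
    by (simp add: TSuc next_flag_def split_beta)
  have turn: "snd (T (Suc k)) \<noteq> mate (snd (T k))" for k
    using other_facet_flag(2)[OF image_flag, of "fst (T k)" "snd (T k)"] Tin[of k]
    by (simp add: TSuc next_flag_def split_beta)
  define es ss where "es = map (fst \<circ> T) [0..<n]" and "ss = map (snd \<circ> T) [0..<n]"
  have hds: "hd es = e" "hd ss = \<sigma>"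
    using n(1) T0 by (auto simp: es_def ss_def hd_map)
  have lasts: "last es = fst (T (n - 1))" "last ss = snd (T (n - 1))"
    using n(1) by (auto simp: es_def ss_def last_map)
  have "edge_cycle P mate \<phi> es ss"
    unfolding edge_cycle_def
  proof (intro conjI allI impI)
    show "es \<noteq> []" "length ss = length es" using n by (auto simp: es_def ss_def)
    show "es ! i edge_of P" "ss ! i facet_of P" "es ! i \<subseteq> ss ! i" if "i < length es" for i
      using that Tin[of i] by (auto simp: es_def ss_def flags_def)
    show "es ! Suc i = \<phi> (ss ! i) ` (es ! i)" "ss ! Suc i \<noteq> mate (ss ! i)"
      if "Suc i < length es" for i
      using that step turn by (auto simp: es_def ss_def)
    show "\<phi> (last ss) ` last es = hd es"
      using step[of "n - 1"] n lasts hds by simp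
    have "tl es = map (fst \<circ> T) [1..<n]" by (simp add: es_def flip: map_tl)
    moreover have "e \<notin> set (map (fst \<circ> T) [1..<n])"
    proof
      assume "e \<in> set (map (fst \<circ> T) [1..<n])"
      then obtain k where "1 \<le> k" "k < n" "fst (T k) = e" by force
      then show False using first[of k] by simp
    qed
    ultimately show "hd es \<notin> set (tl es)" by (simp only: hds(1) not_False_eq_True)
  qed
  then show thesis using that hds by blast
qed

text \<open>
  Since the cycle closes up, the square may straddle the end of the word; indices are therefore
  taken modulo its length.
\<close>

lemma squared_term_imp_adjacent:
  assumes w: "relator P mate \<phi> w" and sq: "has_squared_term w"
  shows "\<exists>\<sigma>. adjacent_faces P \<sigma> (mate \<sigma>)"
proof -
  obtain es ss where cyc: "edge_cycle P mate \<phi> es ss" and w: "w = map \<phi> ss"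
    using w by (auto simp: relator_def)
  define n where "n = length es"
  have len: "length ss = n" and n0: "n > 0" using cyc by (auto simp: edge_cycle_def n_def)
  have flag: "es ! i edge_of P" "ss ! i facet_of P" "es ! i \<subseteq> ss ! i" if "i < n" for i
    using cyc that by (auto simp: edge_cycle_def n_def)
  have step: "es ! (Suc i mod n) = \<phi> (ss ! i) ` (es ! i)" if "i < n" for i
  proof (cases "Suc i = n")
    case True
    then have "n - 1 = i" "ss \<noteq> []" "es \<noteq> []" using len by (auto simp: n_def)
    then have "last ss = ss ! i" "last es = es ! i" "hd es = es ! 0"
      using len n_def by (simp_all add: last_conv_nth hd_conv_nth)
    then show ?thesis using cyc True by (simp add: edge_cycle_def)
  next
    case False
    then show ?thesis using cyc that by (simp add: edge_cycle_def n_def)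
  qed
  obtain k u X v where rot: "rotate k w = u @ [X, X] @ v"
    using sq by (auto simp: has_squared_term_def)
  define j where "j = length u"
  have j: "Suc j < n" using arg_cong[OF rot, of length] w len by (simp add: j_def)
  have "rotate k w ! j = X" "rotate k w ! Suc j = X"
    unfolding rot j_def by (simp_all add: nth_append)
  then have X: "w ! ((j + k) mod n) = X" "w ! ((Suc j + k) mod n) = X"
    using j w len by (auto simp: nth_rotate add.commute)
  define i where "i = (j + k) mod n"
  have i: "i < n" and i': "(Suc j + k) mod n = Suc i mod n"
    using n0 by (auto simp: i_def mod_Suc_eq)
  have "\<phi> (ss ! i) = \<phi> (ss ! (Suc i mod n))"
    using X i i' w len n0 by (simp add: i_def)
  then have same: "ss ! (Suc i mod n) = ss ! i"
    using letter_inj flag(2) i n0 by (metis mod_less_divisor)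
  let ?e = "es ! (Suc i mod n)" and ?s = "ss ! i"
  have "?e edge_of P" "?e \<subseteq> ?s" using flag[of "Suc i mod n"] n0 same by auto
  moreover have "?e \<subseteq> mate ?s"
    using step[OF i] image_facet[OF flag(2)[OF i]] flag(3)[OF i] by blast
  ultimately show ?thesis
    using mate_facet mate_neq flag(2)[OF i] unfolding adjacent_faces_def by metis
qed

text \<open>
  The cycle starts one step before \<open>e\<close>. That the edge moves keeps the cycle from closing up after a
  single letter.
\<close>

lemma squared_term_of_moved_edge:
  assumes \<sigma>: "\<sigma> facet_of P" and e: "e edge_of P" "e \<subseteq> \<sigma>" "e \<subseteq> mate \<sigma>"
    and moved: "\<phi> \<sigma> ` e \<noteq> e"
  shows "\<exists>w. relator P mate \<phi> w \<and> has_squared_term w"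
proof -
  define e1 where "e1 = \<phi> (mate \<sigma>) ` e"
  have "(e, mate \<sigma>) \<in> flags" using \<sigma> e mate_facet by (auto simp: flags_def)
  then have flag: "(e1, \<sigma>) \<in> flags"
    using image_flag[of e "mate \<sigma>"] mate_mate[OF \<sigma>] by (simp add: e1_def)
  have returns: "\<phi> \<sigma> ` e1 = e"
    using mate_image[OF mate_facet[OF \<sigma>] e(3)] mate_mate[OF \<sigma>] by (simp add: e1_def)
  then have "e1 \<noteq> e" using moved by metis
  obtain es ss where cyc: "edge_cycle P mate \<phi> es ss" and hds: "hd es = e1" "hd ss = \<sigma>"
    using edge_cycle_from_flag[OF flag] .
  have len: "length ss = length es" and ne: "es \<noteq> []" using cyc by (auto simp: edge_cycle_def)
  have "length es \<noteq> 1"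
  proof
    assume "length es = 1"
    then have "last es = hd es" "last ss = hd ss" using len by (auto simp: length_Suc_conv)
    then show False using cyc returns hds \<open>e1 \<noteq> e\<close> by (auto simp: edge_cycle_def)
  qed
  then have two: "Suc 0 < length es" using ne by (cases es) auto
  have "ss \<noteq> []" using two len by auto
  have h0: "es ! 0 = e1" "ss ! 0 = \<sigma>"
    using hds ne \<open>ss \<noteq> []\<close> by (simp_all add: hd_conv_nth)
  have "es ! Suc 0 = e" "ss ! Suc 0 \<noteq> mate \<sigma>" "ss ! Suc 0 facet_of P" "e \<subseteq> ss ! Suc 0"
    using cyc two h0 returns unfolding edge_cycle_def by metis+
  then have s1: "ss ! Suc 0 = \<sigma>"
    using other_facet_unique[OF \<open>(e, mate \<sigma>) \<in> flags\<close>] \<sigma> e(2) mate_neq[OF \<sigma>] by metis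
  obtain rest where "ss = \<sigma> # \<sigma> # rest"
    using h0(2) s1 two len by (cases ss; cases "tl ss") auto
  then have "rotate 0 (map \<phi> ss) = [] @ [\<phi> \<sigma>, \<phi> \<sigma>] @ map \<phi> rest" by simp
  then have "has_squared_term (map \<phi> ss)" unfolding has_squared_term_def by blast
  then show ?thesis using cyc unfolding relator_def by blast
qed

lemma edge_class_of_fixed_edge:
  assumes \<sigma>: "\<sigma> facet_of P" and e: "e edge_of P" "e \<subseteq> \<sigma>" "e \<subseteq> mate \<sigma>"
    and fixed: "\<phi> \<sigma> ` e = e"
  shows "edge_class P \<phi> e = {e}"
proof -
  let ?R = "\<lambda>a b. \<exists>\<tau>. \<tau> facet_of P \<and> a edge_of P \<and> a \<subseteq> \<tau> \<and> b = \<phi> \<tau> ` a"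
  have fixed': "\<phi> (mate \<sigma>) ` e = e" using mate_image[OF \<sigma> e(2)] fixed by simp
  have at_e: "\<tau> = \<sigma> \<or> \<tau> = mate \<sigma>" if "\<tau> facet_of P" "e \<subseteq> \<tau>" for \<tau>
    using other_facet_unique[of e "mate \<sigma>"] that \<sigma> e mate_neq mate_facet
    by (metis (mono_tags, lifting) flags_def case_prodI mem_Collect_eq)
  have fwd: "b = e" if "?R e b" for b using that at_e fixed fixed' by metis
  have bwd: "a = e" if R: "?R a e" for a
  proof -
    obtain \<tau> where \<tau>: "\<tau> facet_of P" "a \<subseteq> \<tau>" "e = \<phi> \<tau> ` a" using R by blast
    then have a: "a = \<phi> (mate \<tau>) ` e" using mate_image by metis
    have "e \<subseteq> mate \<tau>" using \<tau> image_facet by blast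
    then have "mate \<tau> = \<sigma> \<or> mate \<tau> = mate \<sigma>" using at_e mate_facet \<tau> by blast
    then show ?thesis using a fixed fixed' by metis
  qed
  have "b = e" if "equivclp ?R e b" for b
    using that by (induction rule: equivclp_induct) (use fwd bwd in blast)+
  then show ?thesis unfolding edge_class_def by auto
qed

end

section \<open>The face pairing of a fundamental polyhedron\<close>

lemma edge_face_pairing_of_fundamental_polyhedron:
  assumes G: "kleinian_group G" and fund: "fundamental_polyhedron G P mate \<phi>"
  shows "edge_face_pairing P mate \<phi>"
proof -
  have P: "convex_polyhedron P" and fp: "face_pairing G P mate \<phi>"
    using fund by (auto simp: fundamental_polyhedron_def)
  obtain Q where Q: "polyhedron Q" "P = Q \<inter> H3" and H: "open H3" "convex H3"
    using convex_polyhedronE[OF P] by metis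
  have mate: "mate \<sigma> facet_of P" "mate \<sigma> \<noteq> \<sigma>" "mate (mate \<sigma>) = \<sigma>" "\<phi> \<sigma> ` \<sigma> = mate \<sigma>"
    "\<phi> \<sigma> ` P \<inter> P = mate \<sigma>" "\<phi> (mate \<sigma>) = inv\<^bsub>BijGroup H3\<^esub> \<phi> \<sigma>" "\<phi> \<sigma> \<in> G"
    if "\<sigma> facet_of P" for \<sigma>
    using fp that unfolding face_pairing_def by blast+
  have iso: "isometry (\<phi> \<sigma>)" if "\<sigma> facet_of P" for \<sigma>
    using G mate(7)[OF that] unfolding kleinian_group_def by blast
  have inv: "\<phi> (mate \<sigma>) (\<phi> \<sigma> x) = x" if \<sigma>: "\<sigma> facet_of P" and x: "x \<in> H3" for \<sigma> x
  proof -
    have bij: "\<phi> \<sigma> \<in> Bij H3" using iso[OF \<sigma>] by (simp add: isometry_def)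
    then have "\<phi> \<sigma> x \<in> H3" using x Bij_imp_funcset by blast
    moreover have "inj_on (\<phi> \<sigma>) H3" using bij by (simp add: Bij_def bij_betw_def)
    ultimately show ?thesis
      using mate(6)[OF \<sigma>] inv_BijGroup[OF bij] x by simp
  qed
  have sub: "\<sigma> \<subseteq> H3" if "\<sigma> facet_of P" for \<sigma>
    using that Q(2) facet_of_imp_subset by blast
  show ?thesis
  proof
    show "finite {F. F face_of P}" using finite_faces_polyhedron_Int_open[OF Q(1) H] Q(2) by simp
    show "\<exists>F G. F \<noteq> G \<and> (\<forall>T. T facet_of P \<and> e \<subseteq> T \<longleftrightarrow> T = F \<or> T = G)" if "e edge_of P" for e
      using edge_in_two_facets[OF P that] .
    fix \<sigma> assume \<sigma>: "\<sigma> facet_of P"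
    show "mate \<sigma> facet_of P" "mate \<sigma> \<noteq> \<sigma>" "mate (mate \<sigma>) = \<sigma>" "\<phi> \<sigma> ` \<sigma> = mate \<sigma>"
      using mate \<sigma> by blast+
    show "\<sigma> = \<tau>" if "\<tau> facet_of P" "\<phi> \<sigma> = \<phi> \<tau>" for \<tau>
      using mate(3,5) \<sigma> that by metis
    show "\<phi> (mate \<sigma>) ` \<phi> \<sigma> ` e = e" if "e \<subseteq> \<sigma>" for e
      using inv[OF \<sigma>] sub[OF \<sigma>] that by force
    show "\<phi> \<sigma> ` e edge_of P" if e: "e edge_of P" "e \<subseteq> \<sigma>" for e
    proof -
      have seg: "\<phi> \<tau> y \<in> open_segment (\<phi> \<tau> x) (\<phi> \<tau> z)"
        if "\<tau> facet_of P" "x \<in> H3" "z \<in> H3" "y \<in> open_segment x z" for \<tau> x y z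
        using isometry_open_segment iso that by blast
      note ms = mate(1)[OF \<sigma>]
      have "convex (mate \<sigma>)" using ms facet_of_imp_face_of face_of_imp_convex by blast
      then have hull: "convex hull (\<phi> \<sigma> ` \<sigma>) = mate \<sigma>" using mate(4)[OF \<sigma>] hull_same by metis
      have eH: "e \<subseteq> H3" using e sub[OF \<sigma>] by blast
      have "e face_of \<sigma>"
        using e \<sigma> by (meson edge_of_def face_of_face facet_of_imp_face_of)
      then have "\<phi> \<sigma> ` e face_of \<phi> \<sigma> ` \<sigma>"
      proof (rule face_of_image_segment_preserving[where g = "\<phi> (mate \<sigma>)", rotated -1])
        show "\<phi> \<sigma> y \<in> open_segment (\<phi> \<sigma> x) (\<phi> \<sigma> z)"
          if "x \<in> \<sigma>" "z \<in> \<sigma>" "y \<in> open_segment x z" for x y z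
          using seg[OF \<sigma>] sub[OF \<sigma>] that by blast
        show "\<phi> (mate \<sigma>) y \<in> open_segment (\<phi> (mate \<sigma>) x) (\<phi> (mate \<sigma>) z)"
          if "x \<in> \<phi> \<sigma> ` \<sigma>" "z \<in> \<phi> \<sigma> ` \<sigma>" "y \<in> open_segment x z" for x y z
          using seg[OF ms] sub[OF ms] that mate(4)[OF \<sigma>] by blast
        show "\<phi> (mate \<sigma>) (\<phi> \<sigma> x) = x" if "x \<in> \<sigma>" for x
          using inv[OF \<sigma>] sub[OF \<sigma>] that by blast
        show "\<phi> \<sigma> (\<phi> (mate \<sigma>) y) = y" if "y \<in> convex hull (\<phi> \<sigma> ` \<sigma>)" for y
          using inv[OF ms, of y] sub[OF ms] that hull mate(3)[OF \<sigma>] by auto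
      qed
      then have "\<phi> \<sigma> ` e face_of P"
        using mate(4)[OF \<sigma>] ms facet_of_imp_face_of face_of_trans by metis
      moreover have "aff_dim (\<phi> \<sigma> ` e) = 1"
      proof (rule aff_dim_1_image_segment_preserving)
        show "\<phi> \<sigma> y \<in> open_segment (\<phi> \<sigma> x) (\<phi> \<sigma> z)"
          if "x \<in> e" "z \<in> e" "y \<in> open_segment x z" for x y z
          using seg[OF \<sigma>] eH that by blast
        show "inj_on (\<phi> \<sigma>) e" using inv[OF \<sigma>] eH by (metis inj_on_inverseI subsetD)
        show "aff_dim e = 1" using e by (simp add: edge_of_def)
      qed
      ultimately show ?thesis by (simp add: edge_of_def)
    qed
  qed
qed

theorem proposition6p3:
  fixes G :: "isom set" and P :: "point set"
    and mate :: "point set \<Rightarrow> point set" and \<phi> :: "point set \<Rightarrow> isom"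
  assumes "kleinian_group G"
    and "convex_ideal_polyhedron P"
    and "fundamental_polyhedron G P mate \<phi>"
    and "\<And>\<sigma>. \<sigma> facet_of P \<Longrightarrow> \<not> elliptic (\<phi> \<sigma>)"
    and "\<And>e. e edge_of P \<Longrightarrow> (\<Sum>e'\<in>edge_class P \<phi> e. dihedral_angle P e') = 2 * pi"
  shows "(\<exists>w. relator P mate \<phi> w \<and> has_squared_term w) \<longleftrightarrow>
         (\<exists>\<sigma> \<tau>. adjacent_faces P \<sigma> \<tau> \<and> mate \<sigma> = \<tau> \<and> \<phi> \<sigma> ` \<sigma> = \<tau>)"
proof -
  interpret edge_face_pairing P mate \<phi>
    using edge_face_pairing_of_fundamental_polyhedron assms(1,3) .
  show ?thesis
  proof
    assume "\<exists>w. relator P mate \<phi> w \<and> has_squared_term w"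
    then obtain \<sigma> where "adjacent_faces P \<sigma> (mate \<sigma>)"
      using squared_term_imp_adjacent by blast
    then show "\<exists>\<sigma> \<tau>. adjacent_faces P \<sigma> \<tau> \<and> mate \<sigma> = \<tau> \<and> \<phi> \<sigma> ` \<sigma> = \<tau>"
      using image_facet unfolding adjacent_faces_def by blast
  next
    assume "\<exists>\<sigma> \<tau>. adjacent_faces P \<sigma> \<tau> \<and> mate \<sigma> = \<tau> \<and> \<phi> \<sigma> ` \<sigma> = \<tau>"
    then obtain \<sigma> e where \<sigma>: "\<sigma> facet_of P" and e: "e edge_of P" "e \<subseteq> \<sigma>" "e \<subseteq> mate \<sigma>"
      by (auto simp: adjacent_faces_def)
    have "\<phi> \<sigma> ` e \<noteq> e"
    proof
      assume "\<phi> \<sigma> ` e = e"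
      then have "edge_class P \<phi> e = {e}" using edge_class_of_fixed_edge \<sigma> e by blast
      then have "dihedral_angle P e = 2 * pi" using assms(5)[OF e(1)] by simp
      moreover have "dihedral_angle P e \<le> pi"
        using dihedral_angle_le_pi assms(3) e(1) by (simp add: fundamental_polyhedron_def)
      ultimately show False using pi_gt_zero by linarith
    qed
    then show "\<exists>w. relator P mate \<phi> w \<and> has_squared_term w"
      using squared_term_of_moved_edge \<sigma> e by blast
  qed
qed

end
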